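(* For all integers $6\le n\le m$, \[ \gamma_{2t}(K_n\Box K_m)\ge\min\bigl\{\gamma_{2t}(K_3\Box K_3)+\gamma_{2t}(K_{n-3}\Box K_{m-3}),\ \gamma_{2t}(K_4\Box K_4)+\gamma_{2t}(K_{n-4}\Box K_{m-4})\bigr\}. \]
   Context: For a graph $G=(V,E)$, a set $S\subseteq V$ is a total $2$-dominating set if every vertex of $V$ (including those in $S$) is adjacent to at least $2$ vertices of $S$; $\gamma_{2t}(G)$ is the minimum cardinality of such a set. $G\Box H$ denotes the Cartesian product: vertex set $V(G)\times V(H)$, with $(u_1,v_1)\sim(u_2,v_2)$ iff either $u_1=u_2$ and $v_1\sim v_2$, or $v_1=v_2$ and $u_1\sim u_2$. $K_n$ is the complete graph on $n$ vertices. *)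

theory Defs
  imports Main
begin

(* A graph is given by a vertex set V and a (symmetric, irreflexive) adjacency relation E. *)

definition total_k_dominating :: "nat \<Rightarrow> 'a set \<Rightarrow> ('a \<Rightarrow> 'a \<Rightarrow> bool) \<Rightarrow> 'a set \<Rightarrow> bool" where
  "total_k_dominating k V E S \<longleftrightarrow> S \<subseteq> V \<and> (\<forall>v\<in>V. card {u\<in>S. E v u} \<ge> k)"

definition gamma2t :: "'a set \<Rightarrow> ('a \<Rightarrow> 'a \<Rightarrow> bool) \<Rightarrow> nat" where
  "gamma2t V E = (LEAST c. \<exists>S. total_k_dominating 2 V E S \<and> card S = c)"

definition K_verts :: "nat \<Rightarrow> nat set" where "K_verts n = {0..<n}"
definition K_adj :: "nat \<Rightarrow> nat \<Rightarrow> bool" where "K_adj u v \<longleftrightarrow> u \<noteq> v"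

definition cart_verts :: "'a set \<Rightarrow> 'b set \<Rightarrow> ('a \<times> 'b) set" where
  "cart_verts V W = V \<times> W"
definition cart_adj :: "('a \<Rightarrow> 'a \<Rightarrow> bool) \<Rightarrow> ('b \<Rightarrow> 'b \<Rightarrow> bool) \<Rightarrow> ('a \<times> 'b) \<Rightarrow> ('a \<times> 'b) \<Rightarrow> bool" where
  "cart_adj E F x y \<longleftrightarrow> (fst x = fst y \<and> F (snd x) (snd y)) \<or> (snd x = snd y \<and> E (fst x) (fst y))"

definition gamma2t_KK :: "nat \<Rightarrow> nat \<Rightarrow> nat" where
  "gamma2t_KK n m = gamma2t (cart_verts (K_verts n) (K_verts m)) (cart_adj K_adj K_adj)"

end

theory Submission
  imports Defs Complex_Main
begin

text \<open>
  Read a set of cells of \<open>K\<^sub>n \<box> K\<^sub>m\<close> as the edge set of a bipartite graph between rows and columns. It is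
  total 2-dominating iff the degrees of the two ends add up to at least 4 on edges and to at least 2
  on non-edges. If some row or column is isolated, there are at least \<open>2 n\<close> edges, while two full
  columns dominate the \<open>(n - 4) \<times> (m - 4)\<close> grid. Otherwise \<open>1 / d + 1 / d' \<le> 4 / 3\<close> on every edge,
  and summing over the edges gives \<open>n + m \<le> 4 / 3 |S|\<close>; in case of equality all degrees are 1 or 3,
  which yields a parity condition. The resulting bound drops by exactly 6 when both \<open>n\<close> and \<open>m\<close> drop
  by 4, and on the smaller grid it is attained by a disjoint union of stars. Only \<open>n = m = 7\<close> needs
  the \<open>3 \<times> 3\<close> summand: there the bound is \<open>11 = 5 + 6\<close>.
\<close>

section \<open>Domination in terms of row and column degrees\<close>

abbreviation row_deg :: "('a \<times> 'b) set \<Rightarrow> 'a \<Rightarrow> nat" where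
  "row_deg S i \<equiv> card (S `` {i})"

abbreviation col_deg :: "('a \<times> 'b) set \<Rightarrow> 'b \<Rightarrow> nat" where
  "col_deg S j \<equiv> card (S\<inverse> `` {j})"

abbreviation rook_dominating :: "nat \<Rightarrow> nat \<Rightarrow> (nat \<times> nat) set \<Rightarrow> bool" where
  "rook_dominating n m \<equiv>
     total_k_dominating 2 (cart_verts (K_verts n) (K_verts m)) (cart_adj K_adj K_adj)"

text \<open>A cell of \<open>S\<close> is counted in its own row and in its own column although it
  is not its own neighbour, hence the correction 2. This is the source of the thresholds 4 and
  2.\<close>

lemma card_rook_neighbours:
  fixes S :: "(nat \<times> nat) set"
  assumes "finite S"
  shows "card {u \<in> S. cart_adj K_adj K_adj (i, j) u} + (if (i, j) \<in> S then 2 else 0)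
         = row_deg S i + col_deg S j"
proof -
  let ?R = "S `` {i}" and ?C = "S\<inverse> `` {j}"
  have fin: "finite ?R" "finite ?C"
    using assms by (auto intro: finite_Image)
  have eq: "{u \<in> S. cart_adj K_adj K_adj (i, j) u}
            = Pair i ` (?R - {j}) \<union> (\<lambda>k. (k, j)) ` (?C - {i})"
    by (auto simp: cart_adj_def K_adj_def)
  have "card {u \<in> S. cart_adj K_adj K_adj (i, j) u} = card (?R - {j}) + card (?C - {i})"
    unfolding eq using fin
    by (subst card_Un_disjoint) (auto simp: card_image inj_on_def)
  moreover have "card (?R - {j}) + (if (i, j) \<in> S then 1 else 0) = card ?R"
    using fin(1) card_Suc_Diff1[of ?R j] by auto
  moreover have "card (?C - {i}) + (if (i, j) \<in> S then 1 else 0) = card ?C"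
    using fin(2) card_Suc_Diff1[of ?C i] by auto
  ultimately show ?thesis by auto
qed

lemma rook_dominating_iff:
  "rook_dominating n m S \<longleftrightarrow> S \<subseteq> {..<n} \<times> {..<m} \<and>
     (\<forall>i<n. \<forall>j<m. row_deg S i + col_deg S j \<ge> (if (i, j) \<in> S then 4 else 2))"
proof (cases "S \<subseteq> {..<n} \<times> {..<m}")
  case True
  then have "finite S" by (rule finite_subset) simp
  then have "2 \<le> card {u \<in> S. cart_adj K_adj K_adj (i, j) u} \<longleftrightarrow>
             row_deg S i + col_deg S j \<ge> (if (i, j) \<in> S then 4 else 2)" for i j
    using card_rook_neighbours[of S i j] by (auto split: if_splits)
  with True show ?thesis
    by (auto simp: total_k_dominating_def cart_verts_def K_verts_def atLeast0LessThan)
qed (auto simp: total_k_dominating_def cart_verts_def K_verts_def atLeast0LessThan)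

lemma gamma2t_KK_le: "rook_dominating n m S \<Longrightarrow> gamma2t_KK n m \<le> card S"
  unfolding gamma2t_KK_def gamma2t_def by (rule Least_le) blast

text \<open>\<open>LEAST\<close> is meaningful only once some dominating set is known, so a witness
  is assumed.\<close>

lemma gamma2t_KK_attained:
  assumes "rook_dominating n m S"
  obtains S' where "rook_dominating n m S'" "card S' = gamma2t_KK n m"
  using LeastI_ex[of "\<lambda>c. \<exists>S. rook_dominating n m S \<and> card S = c"] assms that
  unfolding gamma2t_KK_def gamma2t_def by blast

section \<open>Upper bounds from explicit dominating sets\<close>

lemma rook_dominating_two_columns:
  assumes "2 \<le> n" "2 \<le> m"
  shows "rook_dominating n m ({..<n} \<times> {..<2})"
proof -
  let ?S = "{..<n} \<times> {..<2::nat}"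
  have "?S `` {i} = {..<2}" if "i < n" for i using that by auto
  moreover have "?S\<inverse> `` {j} = (if j < 2 then {..<n} else {})" for j by auto
  ultimately show ?thesis
    using assms by (auto simp: rook_dominating_iff)
qed

lemma gamma2t_KK_le_two_columns:
  assumes "2 \<le> n" "2 \<le> m"
  shows "gamma2t_KK n m \<le> 2 * n"
  using gamma2t_KK_le[OF rook_dominating_two_columns[OF assms]] by simp

text \<open>
  Rows below \<open>a\<close> and columns below \<open>b\<close> are the centres of stars; the other columns and rows are
  distributed cyclically as leaves among them.
\<close>

lemma gamma2t_KK_le_stars:
  assumes "0 < a" "0 < b" "a + 3 * b \<le> n" "3 * a + b \<le> m"
  shows "gamma2t_KK n m \<le> (n - a) + (m - b)"
proof -
  define S where "S = (\<lambda>j. ((j - b) mod a, j)) ` {b..<m} \<union> (\<lambda>i. (i, (i - a) mod b)) ` {a..<n}"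
  have mem: "(i, j) \<in> S \<longleftrightarrow> b \<le> j \<and> j < m \<and> i = (j - b) mod a \<or> a \<le> i \<and> i < n \<and> j = (i - a) mod b"
    for i j by (auto simp: S_def)
  have mod_bounds: "x mod a < a" "x mod b < b" for x using assms by auto
  moreover have "a \<le> n" "b \<le> m" using assms by auto
  ultimately have "x mod a < n" "x mod b < m" for x by (meson less_le_trans)+
  then have sub: "S \<subseteq> {..<n} \<times> {..<m}" by (auto simp: mem)
  then have "finite S" by (rule finite_subset) simp
  then have fin: "finite (S `` {i})" "finite (S\<inverse> `` {j})" for i j
    by (auto intro: finite_Image)
  have row_centre: "3 \<le> row_deg S i" if "i < a" for i
  proof -
    \<comment> \<open>Three of the leaf columns assigned to row \<open>i\<close>; since
      \<open>i < a\<close>, the bound 3a + b \<le> m keeps them inside the grid.\<close>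
    have "{b + i, b + i + a, b + i + 2 * a} \<subseteq> S `` {i}"
      using that assms by (auto simp: mem)
    then have "card {b + i, b + i + a, b + i + 2 * a} \<le> row_deg S i"
      using fin by (intro card_mono)
    then show ?thesis using assms by simp
  qed
  have col_centre: "3 \<le> col_deg S j" if "j < b" for j
  proof -
    have "{a + j, a + j + b, a + j + 2 * b} \<subseteq> S\<inverse> `` {j}"
      using that assms by (auto simp: mem)
    then have "card {a + j, a + j + b, a + j + 2 * b} \<le> col_deg S j"
      using fin by (intro card_mono)
    then show ?thesis using assms by simp
  qed
  have row_pos: "1 \<le> row_deg S i" if "i < n" for i
  proof (cases "i < a")
    case False
    with that have "(i - a) mod b \<in> S `` {i}" by (auto simp: mem)
    then show ?thesis using fin by (metis One_nat_def Suc_leI card_gt_0_iff empty_iff)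
  qed (use row_centre[of i] in auto)
  have col_pos: "1 \<le> col_deg S j" if "j < m" for j
  proof (cases "j < b")
    case False
    with that have "(j - b) mod a \<in> S\<inverse> `` {j}" by (auto simp: mem)
    then show ?thesis using fin by (metis One_nat_def Suc_leI card_gt_0_iff empty_iff)
  qed (use col_centre[of j] in auto)
  have "4 \<le> row_deg S i + col_deg S j" if "(i, j) \<in> S" for i j
  proof -
    have "i < n" "j < m" using that sub by auto
    moreover have "i < a \<or> j < b" using that mod_bounds by (auto simp: mem)
    ultimately show ?thesis
      using row_pos[of i] col_pos[of j] row_centre[of i] col_centre[of j] by linarith
  qed
  moreover have "2 \<le> row_deg S i + col_deg S j" if "i < n" "j < m" for i j
    using row_pos[OF that(1)] col_pos[OF that(2)] by linarith
  ultimately have "rook_dominating n m S"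
    using sub by (simp add: rook_dominating_iff)
  then have "gamma2t_KK n m \<le> card S" by (rule gamma2t_KK_le)
  also have "card S \<le> card {b..<m} + card {a..<n}"
    unfolding S_def by (intro order_trans[OF card_Un_le] add_mono card_image_le) auto
  finally show ?thesis by simp
qed

lemma gamma2t_KK_3_3_le: "gamma2t_KK 3 3 \<le> 5"
proof -
  \<comment> \<open>First row and first column: two stars whose centres are adjacent, as disjoint
    stars need at least a 4 by 4 grid.\<close>
  let ?S = "{(0, 0), (0, 1), (0, 2), (1, 0), (2, 0)} :: (nat \<times> nat) set"
  have im: "?S `` {i} = (if i = 0 then {0, 1, 2} else if i = 1 \<or> i = 2 then {0} else {})"
    "?S\<inverse> `` {i} = (if i = 0 then {0, 1, 2} else if i = 1 \<or> i = 2 then {0} else {})" for i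
    by auto
  have "rook_dominating 3 3 ?S"
    unfolding rook_dominating_iff im by (auto simp: less_Suc_eq numeral_3_eq_3)
  from gamma2t_KK_le[OF this] show ?thesis by simp
qed

section \<open>Lower bounds by degree counting\<close>

lemma card_eq_sum_row_deg:
  fixes n :: nat
  assumes "S \<subseteq> {..<n} \<times> B" "finite S"
  shows "card S = (\<Sum>i<n. row_deg S i)"
proof -
  have "S = Sigma {..<n} (\<lambda>i. S `` {i})" using assms by auto
  then have "card S = card (Sigma {..<n} (\<lambda>i. S `` {i}))" by simp
  also have "\<dots> = (\<Sum>i<n. row_deg S i)"
    using assms(2) by (intro card_SigmaI) (simp_all add: finite_Image)
  finally show ?thesis .
qed

text \<open>A row of degree d > 0 contributes d terms 1/d, that is 1 in total.\<close>

lemma sum_inverse_row_deg: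
  assumes "S \<subseteq> {..<n} \<times> B" "finite S" "\<And>i. i < n \<Longrightarrow> row_deg S i > 0"
  shows "(\<Sum>(i, j)\<in>S. 1 / real (row_deg S i)) = real n"
proof -
  have "S = Sigma {..<n} (\<lambda>i. S `` {i})" using assms by auto
  then have "(\<Sum>(i, j)\<in>S. 1 / real (row_deg S i))
    = (\<Sum>(i, j)\<in>Sigma {..<n} (\<lambda>i. S `` {i}). 1 / real (row_deg S i))" by simp
  also have "\<dots> = (\<Sum>i<n. \<Sum>j\<in>S `` {i}. 1 / real (row_deg S i))"
    using assms(2) by (intro sum.Sigma[symmetric]) (simp_all add: finite_Image)
  also have "\<dots> = (\<Sum>i<n. 1)"
    using assms(3) by (intro sum.cong) fastforce+
  finally show ?thesis by simp
qed

lemma sum_inverse_col_deg: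
  assumes "S \<subseteq> A \<times> {..<m}" "finite S" "\<And>j. j < m \<Longrightarrow> col_deg S j > 0"
  shows "(\<Sum>(i, j)\<in>S. 1 / real (col_deg S j)) = real m"
proof -
  have "(\<Sum>(i, j)\<in>S. 1 / real (col_deg S j)) = (\<Sum>(j, i)\<in>S\<inverse>. 1 / real (col_deg S j))"
    by (rule sum.reindex_bij_witness[of _ prod.swap prod.swap]) auto
  also have "\<dots> = real m"
    using assms by (intro sum_inverse_row_deg[where B = A]) auto
  finally show ?thesis .
qed

text \<open>The extreme pairs are (1, 3) and (3, 1); if both degrees are at least 2, the sum is at
  most 1.\<close>

lemma inverse_add_le_four_thirds:
  fixes d e :: nat
  assumes "0 < d" "0 < e" "4 \<le> d + e"
  shows "1 / real d + 1 / real e \<le> 4 / 3"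
    and "1 / real d + 1 / real e = 4 / 3 \<Longrightarrow> odd d"
proof -
  consider "d = 1" "3 \<le> e" | "e = 1" "3 \<le> d" | "2 \<le> d" "2 \<le> e"
    using assms by linarith
  then have "1 / real d + 1 / real e \<le> 4 / 3 \<and> (1 / real d + 1 / real e = 4 / 3 \<longrightarrow> odd d)"
  proof cases
    case 3
    then have "1 / real d \<le> 1 / 2" "1 / real e \<le> 1 / 2" by (auto simp: field_simps)
    then show ?thesis by linarith
  qed (auto simp: field_simps)
  then show "1 / real d + 1 / real e \<le> 4 / 3"
    and "1 / real d + 1 / real e = 4 / 3 \<Longrightarrow> odd d" by auto
qed

lemma rook_dominating_card_ge:
  assumes S: "rook_dominating n m S"
    and row: "\<And>i. i < n \<Longrightarrow> row_deg S i > 0" and col: "\<And>j. j < m \<Longrightarrow> col_deg S j > 0"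
  shows "3 * (n + m) \<le> 4 * card S"
    and "3 * (n + m) = 4 * card S \<Longrightarrow> even (card S + n)"
proof -
  have sub: "S \<subseteq> {..<n} \<times> {..<m}" using S by (simp add: rook_dominating_iff)
  then have fin: "finite S" by (rule finite_subset) simp
  define w where "w = (\<lambda>(i, j). 1 / real (row_deg S i) + 1 / real (col_deg S j))"
  have total: "sum w S = real (n + m)"
    using sum_inverse_row_deg[OF sub fin row] sum_inverse_col_deg[OF sub fin col]
    by (simp add: w_def case_prod_unfold sum.distrib)
  have edge: "0 < row_deg S i" "0 < col_deg S j" "4 \<le> row_deg S i + col_deg S j"
    if "(i, j) \<in> S" for i j
  proof -
    have "i < n" "j < m" using that sub by auto
    then show "0 < row_deg S i" "0 < col_deg S j" by (auto intro: row col)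
    have "(if (i, j) \<in> S then 4 else 2) \<le> row_deg S i + col_deg S j"
      using S \<open>i < n\<close> \<open>j < m\<close> unfolding rook_dominating_iff by blast
    with that show "4 \<le> row_deg S i + col_deg S j" by simp
  qed
  have w_le: "w p \<le> 4 / 3" if "p \<in> S" for p
    using inverse_add_le_four_thirds(1)[OF edge] that by (cases p) (auto simp: w_def)
  have "sum w S \<le> (\<Sum>p\<in>S. 4 / 3)" using w_le by (rule sum_mono)
  then show "3 * (n + m) \<le> 4 * card S" unfolding total by simp
  assume eq: "3 * (n + m) = 4 * card S"
  then have "(\<Sum>p\<in>S. 4 / 3 - w p) = 0"
    using total by (simp add: sum_subtractf)
  then have tight: "w p = 4 / 3" if "p \<in> S" for p
    using that w_le fin by (subst (asm) sum_nonneg_eq_0_iff) auto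
  have odd_row: "odd (row_deg S i)" if "i < n" for i
  proof -
    obtain j where ij: "(i, j) \<in> S" using row[OF \<open>i < n\<close>] by (auto simp: card_gt_0_iff)
    show ?thesis
      using inverse_add_le_four_thirds(2)[OF edge[OF ij]] tight[OF ij] by (simp add: w_def)
  qed
  \<comment> \<open>All row degrees are odd, so every summand is even; the sum is
    \<open>card S + n\<close>.\<close>
  have "even (\<Sum>i<n. row_deg S i + 1)"
    using odd_row by (intro dvd_sum) auto
  then show "even (card S + n)"
    unfolding card_eq_sum_row_deg[OF sub fin] sum.distrib by simp
qed

text \<open>No cell of an empty row lies in \<open>S\<close>, so each column alone must supply the
  degree 2.\<close>

lemma rook_dominating_isolated_row:
  assumes S: "rook_dominating n m S" and "i < n" "row_deg S i = 0"
  shows "2 * m \<le> card S"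
proof -
  have sub: "S \<subseteq> {..<n} \<times> {..<m}" using S by (simp add: rook_dominating_iff)
  then have fin: "finite S" by (rule finite_subset) simp
  have "2 \<le> row_deg (S\<inverse>) j" if "j < m" for j
    using S assms(2,3) that by (force simp: rook_dominating_iff split: if_splits)
  then have "(\<Sum>j<m. 2) \<le> (\<Sum>j<m. row_deg (S\<inverse>) j)" by (intro sum_mono) auto
  also have "\<dots> = card (S\<inverse>)"
    using sub fin by (intro card_eq_sum_row_deg[symmetric, where B = "{..<n}"]) auto
  finally show ?thesis by simp
qed

lemma rook_dominating_isolated_col:
  assumes S: "rook_dominating n m S" and "j < m" "col_deg S j = 0"
  shows "2 * n \<le> card S"
proof -
  have sub: "S \<subseteq> {..<n} \<times> {..<m}" using S by (simp add: rook_dominating_iff)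
  then have fin: "finite S" by (rule finite_subset) simp
  have "2 \<le> row_deg S i" if "i < n" for i
    using S assms(2,3) that by (force simp: rook_dominating_iff split: if_splits)
  then have "(\<Sum>i<n. 2) \<le> (\<Sum>i<n. row_deg S i)" by (intro sum_mono) auto
  also have "\<dots> = card S"
    using sub fin by (intro card_eq_sum_row_deg[symmetric, where B = "{..<m}"]) auto
  finally show ?thesis by simp
qed

section \<open>Comparing the bounds on the two grids\<close>

theorem theorem8:
  fixes n m :: nat
  assumes "6 \<le> n" and "n \<le> m"
  shows "gamma2t_KK n m \<ge> min (gamma2t_KK 3 3 + gamma2t_KK (n - 3) (m - 3))
                                (gamma2t_KK 4 4 + gamma2t_KK (n - 4) (m - 4))"
proof -
  obtain S where S: "rook_dominating n m S" and card_S: "card S = gamma2t_KK n m"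
    using gamma2t_KK_attained[OF rook_dominating_two_columns[of n m]] assms by auto
  have g33: "gamma2t_KK 3 3 \<le> 5" by (rule gamma2t_KK_3_3_le)
  have g44: "gamma2t_KK 4 4 \<le> 6" using gamma2t_KK_le_stars[of 1 1 4 4] by simp
  have two_cols: "gamma2t_KK (n - 4) (m - 4) \<le> 2 * (n - 4)"
    using assms by (intro gamma2t_KK_le_two_columns) simp_all
  show ?thesis
  proof (cases "2 * n \<le> card S + 2")
    case True
    \<comment> \<open>Here card S \<ge> 2n - 2 = 2(n - 4) + 6.\<close>
    then show ?thesis
      using two_cols g44 card_S assms by linarith
  next
    case False
    have row: "row_deg S i > 0" if "i < n" for i
      using rook_dominating_isolated_row[OF S that] False assms by (cases "row_deg S i") auto
    have col: "col_deg S j > 0" if "j < m" for j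
      using rook_dominating_isolated_col[OF S that] False assms by (cases "col_deg S j") auto
    have bound: "3 * (n + m) \<le> 4 * card S"
      "3 * (n + m) = 4 * card S \<Longrightarrow> even (card S + n)"
      using rook_dominating_card_ge[OF S] row col by blast+
    show ?thesis
    proof (cases "n = 7 \<and> m = 7")
      case True
      \<comment> \<open>42 \<le> 4 card S gives card S \<ge> 11, and both 7 - 3 equal 4.\<close>
      then show ?thesis using bound(1) g33 g44 card_S by simp
    next
      case not77: False
      \<comment> \<open>The smaller grid is covered by \<open>a + b = t - 2 - e\<close> stars, where \<open>e\<close> flags the parity obstruction
        to equality in the degree bound.\<close>
      define t where "t = (n + m) div 4"
      \<comment> \<open>The largest b with a + 3b + 4 \<le> n when a + b = t - 2.\<close>
      define b where "b = (n - 2 - t) div 2"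
      define e where "e = (if n + m = 4 * t \<and> odd (n + t) then 1 else 0 :: nat)"
      define a where "a = t - 2 - b - e"
      have t: "4 * t \<le> n + m" "n + m \<le> 4 * t + 3" unfolding t_def by linarith+
      have e: "e \<le> 1" "e = 1 \<Longrightarrow> n + m = 4 * t" by (auto simp: e_def split: if_splits)
      \<comment> \<open>The degree bound rounded up is n + m - t; the parity condition adds one when
        e = 1.\<close>
      have card_ge: "n + m + e \<le> card S + t"
      proof (cases "e = 1")
        case True
        then have nm: "n + m = 4 * t" "odd (n + t)" by (auto simp: e_def split: if_splits)
        have "card S \<noteq> 3 * t" using bound(2) nm by auto
        moreover have "3 * t \<le> card S" using bound(1) nm(1) by simp
        ultimately show ?thesis using nm(1) e(1) by linarith
      next
        case False
        then have "e = 0" using e(1) by linarith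
        then show ?thesis using bound(1) t(2) by simp
      qed
      \<comment> \<open>The negated case gives m + e + 3 \<le> n + t, so 3t + 3 \<le> 2n, and 6
        \<le> n suffices. The subtraction in \<open>b\<close> is thus not truncated.\<close>
      have "t + 3 \<le> n" using False card_ge t e assms by linarith
      then have b: "t + 2 * b + 2 \<le> n" "n \<le> t + 2 * b + 3" unfolding b_def by linarith+
      have b_cases: "n = t + 2 * b + 2 \<or> n = t + 2 * b + 3" using b by linarith
      have parity: "n = t + 2 * b + 2 \<or> e = 1" if "n + m = 4 * t"
        using that b_cases by (auto simp: e_def)
      have parity': "n = t + 2 * b + 3" if "e = 1"
        using that b_cases by (auto simp: e_def split: if_splits)
      \<comment> \<open>For n = 6 only m = 6 would remain, where t = 3 and parity forces e = 1,
        hence card S \<ge> 10 = 2n - 2.\<close>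
      have "n \<noteq> 6"
      proof
        assume "n = 6"
        then have "t = 3" "m = 6" "e = 0" using False card_ge t(1) assms by linarith+
        with \<open>n = 6\<close> show False by (simp add: e_def)
      qed
      then have "7 \<le> n" using assms by linarith
      then have "0 < b" using b False card_ge t assms by linarith
      \<comment> \<open>Needed for a > 0. Failure forces e = 0, t \<le> 3 and m = n \<le> 7, leaving
        only the excluded 7 by 7 grid.\<close>
      moreover have "t \<ge> b + e + 3"
      proof (rule ccontr)
        assume less: "\<not> b + e + 3 \<le> t"
        have "e = 0"
        proof (rule ccontr)
          assume "e \<noteq> 0"
          then have "e = 1" using e(1) by linarith
          then show False
            using less False card_ge e(2) parity' assms by linarith
        qed
        then have "t \<le> 3" using less b t assms by linarith
        then have "m = n" using False card_ge assms by linarith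
        with \<open>t \<le> 3\<close> have "n \<le> 7" using t by linarith
        with \<open>m = n\<close> \<open>7 \<le> n\<close> not77 show False by linarith
      qed
      ultimately have "0 < a" "0 < b" and a: "a + b + e + 2 = t"
        unfolding a_def by linarith+
      have rows: "a + 3 * b + 4 \<le> n" using a b(1) by linarith
      \<comment> \<open>As 2b \<ge> n - t - 3, it suffices that 4t + 1 \<le> n + m + 3e. If n + m =
        4t and e = 0, parity makes 2b = n - t - 2, which saves the missing unit.\<close>
      have cols: "3 * a + b + 4 \<le> m"
      proof (cases "n + m = 4 * t \<and> e = 0")
        case True
        then have "n = t + 2 * b + 2" using parity by simp
        then show ?thesis using True a by linarith
      next
        case False
        then have "4 * t + 1 \<le> n + m + e" using t(1) e(1) by linarith
        then show ?thesis using a b(2) by linarith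
      qed
      have "gamma2t_KK (n - 4) (m - 4) \<le> (n - 4 - a) + (m - 4 - b)"
        using \<open>0 < a\<close> \<open>0 < b\<close> rows cols by (intro gamma2t_KK_le_stars) simp_all
      moreover have "(n - 4 - a) + (m - 4 - b) + 8 + a + b = n + m" using rows cols by simp
      \<comment> \<open>Since a + b = t - 2 - e, the stars have n + m + e - t - 6 cells, at most
        card S - 6.\<close>
      ultimately have "gamma2t_KK (n - 4) (m - 4) + 6 \<le> card S" using a card_ge by linarith
      then show ?thesis using g44 card_S by linarith
    qed
  qed
qed

end
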